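(* Consider the two-qubit discrete-time collisional dynamics $\Lambda_n\otimes\Lambda_n$ defined in the context, with parameters $r=0$, $p=\tfrac14+\epsilon$, $\Delta=\tfrac{1-2p}{2}$, $p_0=1-2p$, where $0<\epsilon<\tfrac14$. Let $\mathcal{I}^{(n)}_{(S+S)E}$ be the two-qubit–environment mutual information at discrete time $n$ (defined in the context) for the initial two-qubit state $\rho_{S+S}=P_2^+$, the projector onto $\tfrac1{\sqrt2}(|00\rangle+|11\rangle)$. Then, as $\epsilon\to0^+$, $$\mathcal{I}^{(2)}_{(S+S)E}-\mathcal{I}^{(1)}_{(S+S)E}=-4\log\!\big(\tfrac43\big)\,\epsilon^2+O(\epsilon^3);$$ in particular, for sufficiently small $\epsilon>0$ the system-environment mutual information strictly decreases between the first and the second collision.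
   Context: $\sigma_1,\sigma_2,\sigma_3$ are the Pauli matrices, $\sigma_0=\mathbb{1}_2$, and $\phi_k[X]=\sigma_kX\sigma_k$ on $M_2(\mathbb{C})$, $k=0,\dots,3$. The transition matrix (rows and columns indexed by $0,1,2,3$) is $$T=\begin{pmatrix}p_0&p_0&p_0&p_0\\ p&p+\Delta&p-\Delta&p\\ p&p-\Delta&p+\Delta&p\\ r&r&r&r\end{pmatrix},$$ with invariant probability vector $(p_0,p,p,r)$, entries denoted $p_i$, $i=0,\dots,3$ (so $p_1=p_2=p$, $p_3=r$). Put $p_{i_1\cdots i_n}=T_{i_ni_{n-1}}\cdots T_{i_2i_1}p_{i_1}$, $\phi_{i_1\cdots i_n}=\phi_{i_n}\circ\cdots\circ\phi_{i_1}$ and $\Lambda_n=\sum_{i_1,\dots,i_n}p_{i_1\cdots i_n}\phi_{i_1\cdots i_n}$. Each qubit interacts with its own copy of a classical Markov chain environment with these probabilities. With $S(\rho)=-\mathrm{Tr}\,\rho\log\rho$ the von Neumann entropy (natural logarithm), the mutual information between the two qubits and the environment at discrete time $n$ is $$\mathcal{I}^{(n)}_{(S+S)E}=S\big(\Lambda_n\otimes\Lambda_n[\rho_{S+S}]\big)-\sum_{i_1,\dots,i_n}\;\sum_{k_1,\dots,k_n}p_{i_1\cdots i_n}\,p_{k_1\cdots k_n}\,S\big(\phi_{i_1\cdots i_n}\otimes\phi_{k_1\cdots k_n}[\rho_{S+S}]\big),$$ which, since the $\phi_k$ are unitary conjugations, equals $S(\Lambda_n\otimes\Lambda_n[\rho_{S+S}])-S(\rho_{S+S})$.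 *)

theory Defs
  imports "HOL-Analysis.Analysis" "HOL-Library.Landau_Symbols"
begin

section \<open>Von Neumann entropy\<close>

definition adjoint_mat :: "complex^'n^'m \<Rightarrow> complex^'m^'n" where
  "adjoint_mat A = (\<chi> i j. cnj (A $ j $ i))"

definition unitary_mat :: "complex^'n^'n \<Rightarrow> bool" where
  "unitary_mat U \<longleftrightarrow> adjoint_mat U ** U = mat 1 \<and> U ** adjoint_mat U = mat 1"

definition diag_mat :: "('n \<Rightarrow> real) \<Rightarrow> complex^'n^'n" where
  "diag_mat d = (\<chi> i j. if i = j then of_real (d i) else 0)"

text \<open>Functional calculus for Hermitian matrices: the value does not depend on the
  diagonalization chosen. Nothing is claimed for matrices that are not Hermitian.\<close>

definition mat_fun :: "(real \<Rightarrow> real) \<Rightarrow> complex^'n^'n \<Rightarrow> complex^'n^'n" where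
  "mat_fun f A = (SOME B. \<exists>U d. unitary_mat U \<and>
     A = U ** diag_mat d ** adjoint_mat U \<and>
     B = U ** diag_mat (\<lambda>i. f (d i)) ** adjoint_mat U)"

text \<open>As \<open>ln 0 = 0\<close> for reals, the usual convention \<open>0 log 0 = 0\<close> is built in.\<close>

definition vn_entropy :: "complex^'n^'n \<Rightarrow> real" where
  "vn_entropy \<rho> = - Re (trace (\<rho> ** mat_fun ln \<rho>))"


section \<open>Two-qubit matrices and tensor products of maps\<close>

text \<open>The basis vectors \<open>|0\<rangle>\<close>, \<open>|1\<rangle>\<close> of a qubit correspond to the
  elements \<open>1\<close>, \<open>2\<close> of the index type \<open>2\<close>, and \<open>|ab\<rangle>\<close> to the index \<open>(a, b)\<close>.\<close>

type_synonym qubit_mat = "complex^2^2"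
type_synonym two_qubit_mat = "complex^(2 \<times> 2)^(2 \<times> 2)"

definition kron :: "qubit_mat \<Rightarrow> qubit_mat \<Rightarrow> two_qubit_mat" where
  "kron A B = (\<chi> a b. A $ fst a $ fst b * B $ snd a $ snd b)"

definition mat_unit :: "2 \<Rightarrow> 2 \<Rightarrow> qubit_mat" where
  "mat_unit i j = (\<chi> a b. if a = i \<and> b = j then 1 else 0)"

definition scale_mat :: "complex \<Rightarrow> complex^'n^'m \<Rightarrow> complex^'n^'m" where
  "scale_mat c A = (\<chi> a b. c * A $ a $ b)"

text \<open>For complex-linear \<open>F\<close>, \<open>G\<close>, this is the linear map with
  \<open>kron A B \<mapsto> kron (F A) (G B)\<close>, expanded in matrix units.\<close>

definition tensor_map ::
    "(qubit_mat \<Rightarrow> qubit_mat) \<Rightarrow> (qubit_mat \<Rightarrow> qubit_mat) \<Rightarrow> two_qubit_mat \<Rightarrow> two_qubit_mat" where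
  "tensor_map F G X = (\<Sum>i\<in>UNIV. \<Sum>j\<in>UNIV. \<Sum>k\<in>UNIV. \<Sum>l\<in>UNIV.
     scale_mat (X $ (i, k) $ (j, l)) (kron (F (mat_unit i j)) (G (mat_unit k l))))"

definition bell_vec :: "complex^(2 \<times> 2)" where
  "bell_vec = (\<chi> a. if fst a = snd a then 1 / of_real (sqrt 2) else 0)"

definition bell_proj :: two_qubit_mat where
  "bell_proj = (\<chi> a b. bell_vec $ a * cnj (bell_vec $ b))"


section \<open>Collisional dynamics driven by a classical Markov chain\<close>

text \<open>Only the indices \<open>0, \<dots>, 3\<close> are meaningful below.\<close>

definition pauli :: "nat \<Rightarrow> qubit_mat" where
  "pauli k = [mat 1,
              vector [vector [0, 1], vector [1, 0]],
              vector [vector [0, - \<i>], vector [\<i>, 0]],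
              vector [vector [1, 0], vector [0, - 1]]] ! k"

definition pauli_map :: "nat \<Rightarrow> qubit_mat \<Rightarrow> qubit_mat" where
  "pauli_map k X = pauli k ** X ** pauli k"

definition transition_mat :: "real \<Rightarrow> real \<Rightarrow> real \<Rightarrow> real \<Rightarrow> nat \<Rightarrow> nat \<Rightarrow> real" where
  "transition_mat p0 p \<Delta> r i j =
     [[p0, p0,    p0,    p0],
      [p,  p + \<Delta>, p - \<Delta>, p],
      [p,  p - \<Delta>, p + \<Delta>, p],
      [r,  r,     r,     r]] ! i ! j"

definition invariant_vec :: "real \<Rightarrow> real \<Rightarrow> real \<Rightarrow> nat \<Rightarrow> real" where
  "invariant_vec p0 p r i = [p0, p, p, r] ! i"

definition paths :: "nat \<Rightarrow> nat list set" where
  "paths n = {is. length is = n \<and> set is \<subseteq> {0..3}}"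

text \<open>The path \<open>i\<^sub>1, \<dots>, i\<^sub>n\<close> is the list \<open>[i\<^sub>1, \<dots>, i\<^sub>n]\<close> with \<open>n \<ge> 1\<close>;
  \<open>T i j\<close> is the probability of the transition from \<open>j\<close> to \<open>i\<close>.\<close>

definition path_prob :: "(nat \<Rightarrow> nat \<Rightarrow> real) \<Rightarrow> (nat \<Rightarrow> real) \<Rightarrow> nat list \<Rightarrow> real" where
  "path_prob T \<pi> is = (\<Prod>m<length is - 1. T (is ! Suc m) (is ! m)) * \<pi> (is ! 0)"

definition path_map :: "nat list \<Rightarrow> qubit_mat \<Rightarrow> qubit_mat" where
  "path_map is = fold pauli_map is"

definition dyn_map ::
    "(nat \<Rightarrow> nat \<Rightarrow> real) \<Rightarrow> (nat \<Rightarrow> real) \<Rightarrow> nat \<Rightarrow> qubit_mat \<Rightarrow> qubit_mat" where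
  "dyn_map T \<pi> n X = (\<Sum>is\<in>paths n. path_prob T \<pi> is *\<^sub>R path_map is X)"

definition mutual_info ::
    "(nat \<Rightarrow> nat \<Rightarrow> real) \<Rightarrow> (nat \<Rightarrow> real) \<Rightarrow> nat \<Rightarrow> two_qubit_mat \<Rightarrow> real" where
  "mutual_info T \<pi> n \<rho> =
     vn_entropy (tensor_map (dyn_map T \<pi> n) (dyn_map T \<pi> n) \<rho>)
     - (\<Sum>is\<in>paths n. \<Sum>ks\<in>paths n.
          path_prob T \<pi> is * path_prob T \<pi> ks *
          vn_entropy (tensor_map (path_map is) (path_map ks) \<rho>))"

end

theory Submission
  imports Defs "HOL-Real_Asymp.Real_Asymp"
begin

text \<open>The Pauli matrices multiply, up to phases, like the Klein four-group, so \<open>\<Lambda>\<^sub>n\<close> is a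
  mixture of Pauli conjugations with some weight vector \<open>w\<close> on that group, and
  \<open>\<Lambda>\<^sub>n \<otimes> \<Lambda>\<^sub>n\<close> sends the Bell projector to a Bell-diagonal state whose spectrum is the group
  convolution of \<open>w\<close> with itself. Along each single path the state stays pure, so the mutual
  information is the Shannon entropy of this convolution. To second order in \<open>\<epsilon>\<close>, the second
  collision moves the spectrum by \<open>4 \<epsilon>\<^sup>2 (-1, 1, 1, -1)\<close> around \<open>(3/8, 1/4, 1/4, 1/8)\<close>, which
  changes the entropy by \<open>4 \<epsilon>\<^sup>2 ln (3/8 \<cdot> 1/8 / (1/4)\<^sup>2)\<close>.\<close>

section \<open>Entropy of a diagonalized matrix\<close>

lemma matrix_mult_diag_nth: "(W ** diag_mat d) $ i $ j = W $ i $ j * of_real (d j)"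
  by (simp add: matrix_matrix_mult_def diag_mat_def if_distrib cong: if_cong)

lemma diag_mult_matrix_nth: "(diag_mat d ** W) $ i $ j = of_real (d i) * W $ i $ j"
  by (simp add: matrix_matrix_mult_def diag_mat_def if_distribR if_distrib[of "\<lambda>x. x * _"] cong: if_cong)

text \<open>The unitary \<open>W\<close> = V*U intertwines the two diagonal matrices, so its entry
  at \<open>i\<close>, \<open>j\<close> vanishes unless \<open>d j = e i\<close>. Hence it also
  intertwines their images under \<open>f\<close>. This makes the choice in \<open>mat_fun\<close>
  independent of the diagonalization.\<close>

lemma diagonalization_fun_unique:
  assumes U: "unitary_mat U" and V: "unitary_mat V"
    and eq: "U ** diag_mat d ** adjoint_mat U = V ** diag_mat e ** adjoint_mat V"
  shows "U ** diag_mat (\<lambda>i. f (d i)) ** adjoint_mat U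
    = V ** diag_mat (\<lambda>i. f (e i)) ** adjoint_mat V"
proof -
  define W where "W = adjoint_mat V ** U"
  have U1: "adjoint_mat U ** U = mat 1" "U ** adjoint_mat U = mat 1"
    and V1: "adjoint_mat V ** V = mat 1" "V ** adjoint_mat V = mat 1"
    using U V by (auto simp: unitary_mat_def)
  have "W ** diag_mat d = adjoint_mat V ** (U ** diag_mat d ** adjoint_mat U) ** U"
    by (simp add: W_def U1 flip: matrix_mul_assoc)
  also have "\<dots> = diag_mat e ** W"
    unfolding eq by (simp add: W_def V1 matrix_mul_assoc)
  finally have comm: "W ** diag_mat d = diag_mat e ** W" .
  have "W $ i $ j * of_real (f (d j)) = of_real (f (e i)) * W $ i $ j" for i j
  proof -
    have "W $ i $ j * of_real (d j) = of_real (e i) * W $ i $ j"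
      using comm by (metis matrix_mult_diag_nth diag_mult_matrix_nth)
    then show ?thesis by (cases "W $ i $ j = 0") auto
  qed
  then have comm_f: "W ** diag_mat (\<lambda>i. f (d i)) = diag_mat (\<lambda>i. f (e i)) ** W"
    by (simp add: vec_eq_iff matrix_mult_diag_nth diag_mult_matrix_nth)
  have VW: "V ** W = U" by (simp add: W_def matrix_mul_assoc V1)
  have WU: "W ** adjoint_mat U = adjoint_mat V"
    by (simp add: W_def U1 flip: matrix_mul_assoc)
  have "U ** diag_mat (\<lambda>i. f (d i)) ** adjoint_mat U
      = V ** (W ** diag_mat (\<lambda>i. f (d i))) ** adjoint_mat U"
    by (simp add: VW matrix_mul_assoc)
  also have "\<dots> = V ** diag_mat (\<lambda>i. f (e i)) ** (W ** adjoint_mat U)"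
    unfolding comm_f by (simp add: matrix_mul_assoc)
  finally show ?thesis unfolding WU .
qed

lemma mat_fun_diagonalization:
  assumes "unitary_mat U"
  shows "mat_fun f (U ** diag_mat d ** adjoint_mat U)
    = U ** diag_mat (\<lambda>i. f (d i)) ** adjoint_mat U"
  unfolding mat_fun_def
proof (rule some_equality, goal_cases)
  case 1
  then show ?case using assms by blast
next
  case (2 B)
  then show ?case using diagonalization_fun_unique[OF assms] by metis
qed

lemma vn_entropy_diagonalization:
  assumes "unitary_mat U"
  shows "vn_entropy (U ** diag_mat d ** adjoint_mat U) = - (\<Sum>i\<in>UNIV. d i * ln (d i))"
proof -
  have U1: "adjoint_mat U ** U = mat 1"
    using assms by (simp add: unitary_mat_def)
  have "trace ((U ** diag_mat d ** adjoint_mat U) ** (U ** diag_mat (\<lambda>i. ln (d i)) ** adjoint_mat U))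
      = trace (U ** diag_mat d ** (adjoint_mat U ** U) ** diag_mat (\<lambda>i. ln (d i)) ** adjoint_mat U)"
    by (simp add: matrix_mul_assoc)
  also have "\<dots> = trace (U ** (diag_mat d ** diag_mat (\<lambda>i. ln (d i)) ** adjoint_mat U))"
    unfolding U1 by (simp add: matrix_mul_assoc)
  \<comment> \<open>Cyclicity of the trace brings the outer \<open>U\<close> next to its
    adjoint.\<close>
  also have "\<dots> = trace (diag_mat d ** diag_mat (\<lambda>i. ln (d i)) ** (adjoint_mat U ** U))"
    by (subst trace_mul_sym) (simp add: matrix_mul_assoc)
  also have "\<dots> = (\<Sum>i\<in>UNIV. of_real (d i * ln (d i)))"
    unfolding U1 by (simp add: trace_def matrix_mult_diag_nth) (simp add: diag_mat_def)
  finally show ?thesis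
    by (simp add: vn_entropy_def mat_fun_diagonalization[OF assms] del: of_real_mult)
qed


section \<open>Pauli maps and Bell-diagonal states\<close>

lemma sum_two_by_two: "(\<Sum>x\<in>(UNIV :: (2 \<times> 2) set). f x) = f (1, 1) + f (1, 2) + f (2, 1) + f (2, 2)"
proof -
  have "(\<Sum>x\<in>UNIV. f x) = (\<Sum>i\<in>UNIV. \<Sum>j\<in>UNIV. f (i, j))"
    unfolding sum.cartesian_product by simp
  then show ?thesis by (simp add: sum_2 add.assoc)
qed

lemma sum_lessThan_4: "(\<Sum>k<(4::nat). f k) = f 0 + f 1 + f 2 + f 3"
  by (simp add: eval_nat_numeral add.assoc)

lemma less_4_cases:
  assumes "k < (4::nat)"
  obtains "k = 0" | "k = 1" | "k = 2" | "k = 3"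
  using assms by linarith

lemma pauli_eqs:
  "pauli 0 = mat 1"
  "pauli (Suc 0) = vector [vector [0, 1], vector [1, 0]]"
  "pauli 2 = vector [vector [0, - \<i>], vector [\<i>, 0]]"
  "pauli 3 = vector [vector [1, 0], vector [0, - 1]]"
  by (simp_all add: pauli_def numeral_2_eq_2 numeral_3_eq_3)

lemmas qubit_simps = vec_eq_iff forall_2 sum_2 matrix_matrix_mult_def pauli_eqs mat_def

text \<open>In this labelling the Klein four-group is bitwise XOR of the indices.\<close>

lemma xor_less_4: "i < (4::nat) \<Longrightarrow> j < 4 \<Longrightarrow> xor i j < 4"
  by (elim less_4_cases) simp_all

text \<open>A product of two Pauli matrices is a phase times the Pauli matrix at the XOR of their
  indices. The reversed product carries the conjugate phase, so the phases cancel in the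
  conjugation.\<close>

lemma pauli_map_pauli_map:
  assumes "i < 4" "j < 4"
  shows "pauli_map i (pauli_map j X) = pauli_map (xor i j) X"
  using assms by (elim less_4_cases) (simp_all add: pauli_map_def qubit_simps mult_ac)

definition path_index :: "nat list \<Rightarrow> nat" where
  "path_index is = fold xor is 0"

text \<open>The starting index \<open>k\<close> is arbitrary so that the induction can absorb the
  first collision into it. The bound on the folded index is carried along for the next
  composition.\<close>

lemma path_map_fold:
  assumes "set is \<subseteq> {0..3}" "k < 4"
  shows "path_map is (pauli_map k X) = pauli_map (fold xor is k) X \<and> fold xor is k < 4"
  using assms
proof (induction "is" arbitrary: k)
  case (Cons i "is")
  then have "i < 4" by auto
  then show ?case
    using Cons by (simp add: path_map_def pauli_map_pauli_map xor_less_4)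
qed (simp add: path_map_def)

lemma path_map_eq_pauli_map:
  assumes "is \<in> paths n"
  shows "path_map is = pauli_map (path_index is)" "path_index is < 4"
proof -
  have "pauli_map 0 X = X" for X
    by (simp add: pauli_map_def pauli_eqs)
  then show "path_map is = pauli_map (path_index is)" "path_index is < 4"
    using assms path_map_fold[of "is" 0] by (auto simp: paths_def path_index_def fun_eq_iff)
qed

definition pauli_channel :: "(nat \<Rightarrow> real) \<Rightarrow> qubit_mat \<Rightarrow> qubit_mat" where
  "pauli_channel w X = (\<Sum>k<4. w k *\<^sub>R pauli_map k X)"

text \<open>Column \<open>m\<close> is the vectorized Pauli matrix of index \<open>bell_index m\<close>, normalized:
  these are the four Bell states up to phases.\<close>

definition bell_index :: "2 \<times> 2 \<Rightarrow> nat" where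
  "bell_index m = (if fst m = 1 then if snd m = 1 then 0 else 1 else if snd m = 1 then 2 else 3)"

definition bell_basis :: two_qubit_mat where
  "bell_basis = (\<chi> a m. pauli (bell_index m) $ fst a $ snd a / of_real (sqrt 2))"

lemma sqrt2_square: "complex_of_real (sqrt 2) * complex_of_real (sqrt 2) = 2"
  by (metis of_real_mult of_real_numeral real_sqrt_mult_self abs_numeral)

text \<open>Pauli matrices divided by the square root of 2 are orthonormal for the Hilbert-Schmidt
  inner product, which vectorization turns into the standard one.\<close>

lemma unitary_bell_basis: "unitary_mat bell_basis"
  by (simp add: unitary_mat_def bell_basis_def bell_index_def adjoint_mat_def qubit_simps
      split_paired_All sum_two_by_two sqrt2_square)

text \<open>This is convolution on the Klein four-group: every element is its own inverse, so
  \<open>xor k m\<close> plays the role of m - k.\<close>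

definition xor_convolution :: "(nat \<Rightarrow> real) \<Rightarrow> (nat \<Rightarrow> real) \<Rightarrow> nat \<Rightarrow> real" where
  "xor_convolution v w m = (\<Sum>k<4. v k * w (xor k m))"

lemma bell_proj_nth:
  "bell_proj $ (i, k) $ (j, l) = (if i = k \<and> j = l then 1 / 2 else 0)"
  by (simp add: bell_proj_def bell_vec_def sqrt2_square)

lemma tensor_map_bell_proj_nth:
  "tensor_map F G bell_proj $ a $ b
    = (\<Sum>i\<in>UNIV. \<Sum>j\<in>UNIV. F (mat_unit i j) $ fst a $ fst b * G (mat_unit i j) $ snd a $ snd b / 2)"
  by (simp add: tensor_map_def scale_mat_def kron_def bell_proj_nth sum_2)

text \<open>Conjugation by Pauli matrices 1 and 2 exchanges the indices of the qubit, while 2 and 3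
  flip the sign of the off-diagonal entries.\<close>

lemma pauli_channel_nth:
  "pauli_channel w X $ 1 $ 1 = of_real (w 0 + w 3) * X $ 1 $ 1 + of_real (w 1 + w 2) * X $ 2 $ 2"
  "pauli_channel w X $ 2 $ 2 = of_real (w 0 + w 3) * X $ 2 $ 2 + of_real (w 1 + w 2) * X $ 1 $ 1"
  "pauli_channel w X $ 1 $ 2 = of_real (w 0 - w 3) * X $ 1 $ 2 + of_real (w 1 - w 2) * X $ 2 $ 1"
  "pauli_channel w X $ 2 $ 1 = of_real (w 0 - w 3) * X $ 2 $ 1 + of_real (w 1 - w 2) * X $ 1 $ 2"
  by (simp_all add: pauli_channel_def sum_lessThan_4 pauli_map_def qubit_simps
      scaleR_conv_of_real[of _ "_ :: complex"]
      algebra_simps)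

text \<open>The tensor product of matrices A and B sends the vectorized identity to the
  vectorization of A times the transpose of B. Transposing a Pauli matrix changes at most its sign,
  so the pair \<open>i\<close>, \<open>j\<close> yields the Bell state of index
  \<open>xor i j\<close> up to phase, and the weights of equal XOR add up to the
  convolution.\<close>

lemma tensor_map_pauli_channel_bell_proj:
  "tensor_map (pauli_channel v) (pauli_channel w) bell_proj
    = bell_basis ** diag_mat (\<lambda>m. xor_convolution v w (bell_index m)) ** adjoint_mat bell_basis"
proof -
  have nth: "(bell_basis ** diag_mat d ** adjoint_mat bell_basis) $ a $ b
    = (\<Sum>m\<in>UNIV. pauli (bell_index m) $ fst a $ snd a * of_real (d m)
        * cnj (pauli (bell_index m) $ fst b $ snd b) / 2)" for d a b
    by (simp add: matrix_matrix_mult_def[of "bell_basis ** _"] matrix_mult_diag_nth adjoint_mat_def)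
      (simp add: bell_basis_def sqrt2_square)
  show ?thesis
    by (simp add: vec_eq_iff[of "tensor_map _ _ _"] vec_eq_iff[of "tensor_map _ _ _ $ _"]
        split_paired_All forall_2 nth tensor_map_bell_proj_nth sum_2 sum_two_by_two
        pauli_channel_nth mat_unit_def bell_index_def pauli_eqs mat_def
        xor_convolution_def sum_lessThan_4 field_simps)
qed

lemma vn_entropy_pauli_channels:
  "vn_entropy (tensor_map (pauli_channel v) (pauli_channel w) bell_proj)
    = - (\<Sum>m<4. xor_convolution v w m * ln (xor_convolution v w m))"
  unfolding tensor_map_pauli_channel_bell_proj vn_entropy_diagonalization[OF unitary_bell_basis]
  by (simp add: sum_two_by_two bell_index_def sum_lessThan_4)


section \<open>Mutual information as a Shannon entropy\<close>

definition pauli_weight :: "(nat \<Rightarrow> nat \<Rightarrow> real) \<Rightarrow> (nat \<Rightarrow> real) \<Rightarrow> nat \<Rightarrow> nat \<Rightarrow> real" where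
  "pauli_weight T \<pi> n k = (\<Sum>is\<in>paths n. if path_index is = k then path_prob T \<pi> is else 0)"

lemma dyn_map_eq_pauli_channel: "dyn_map T \<pi> n = pauli_channel (pauli_weight T \<pi> n)"
proof
  fix X
  \<comment> \<open>A sum over the possible values of \<open>path_index\<close> is inserted so that,
    after swapping the sums, paths are grouped by their overall Pauli index.\<close>
  have "dyn_map T \<pi> n X
      = (\<Sum>is\<in>paths n. \<Sum>k<4. if path_index is = k then path_prob T \<pi> is *\<^sub>R pauli_map k X else 0)"
    unfolding dyn_map_def
    by (rule sum.cong) (auto simp: path_map_eq_pauli_map sum.delta')
  also have "\<dots> = pauli_channel (pauli_weight T \<pi> n) X"
    unfolding pauli_channel_def pauli_weight_def scaleR_sum_left
    by (subst sum.swap) (auto intro!: sum.cong)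
  finally show "dyn_map T \<pi> n X = pauli_channel (pauli_weight T \<pi> n) X" .
qed

lemma pauli_map_eq_pauli_channel:
  assumes "k < 4"
  shows "pauli_map k = pauli_channel (\<lambda>j. if j = k then 1 else 0)"
proof
  fix X
  have "pauli_channel (\<lambda>j. if j = k then 1 else 0) X = (\<Sum>j<4. if j = k then pauli_map j X else 0)"
    unfolding pauli_channel_def by (rule sum.cong) auto
  then show "pauli_map k X = pauli_channel (\<lambda>j. if j = k then 1 else 0) X"
    using assms by simp
qed

text \<open>A single path gives point masses as weights. Their convolution is again a point mass,
  that is, the spectrum of a pure state.\<close>

lemma vn_entropy_path_maps:
  assumes "is \<in> paths n" "ks \<in> paths n"
  shows "vn_entropy (tensor_map (path_map is) (path_map ks) bell_proj) = 0"
proof -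
  define v w where "v = (\<lambda>j. if j = path_index is then 1 else (0::real))"
    and "w = (\<lambda>j. if j = path_index ks then 1 else (0::real))"
  have maps: "path_map is = pauli_channel v" "path_map ks = pauli_channel w"
    using assms by (simp_all add: path_map_eq_pauli_map pauli_map_eq_pauli_channel v_def w_def)
  have "xor_convolution v w m = (\<Sum>j<4. if j = path_index is then w (xor j m) else 0)" for m
    unfolding xor_convolution_def by (rule sum.cong) (auto simp: v_def)
  then have "xor_convolution v w m = w (xor (path_index is) m)" for m
    using path_map_eq_pauli_map(2)[OF assms(1)] by simp
  \<comment> \<open>The convolution takes only the values 0 and 1, and x ln x vanishes at
    both.\<close>
  then have "xor_convolution v w m * ln (xor_convolution v w m) = 0" for m
    unfolding w_def by simp
  then show ?thesis
    unfolding maps vn_entropy_pauli_channels by (simp only: sum.neutral_const minus_zero)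
qed

lemma mutual_info_bell_proj:
  "mutual_info T \<pi> n bell_proj
    = - (\<Sum>m<4. xor_convolution (pauli_weight T \<pi> n) (pauli_weight T \<pi> n) m
          * ln (xor_convolution (pauli_weight T \<pi> n) (pauli_weight T \<pi> n) m))"
  by (simp add: mutual_info_def vn_entropy_path_maps dyn_map_eq_pauli_channel
      vn_entropy_pauli_channels)

lemma paths_0: "paths 0 = {[]}"
  by (auto simp: paths_def)

lemma sum_paths_Suc: "(\<Sum>is\<in>paths (Suc n). f is) = (\<Sum>i<4. \<Sum>is\<in>paths n. f (i # is))"
proof -
  have "paths (Suc n) = (\<lambda>(i, is). i # is) ` ({..<4} \<times> paths n)"
    by (force simp: paths_def length_Suc_conv image_iff)
  moreover have "inj_on (\<lambda>(i, is). i # is) ({..<4} \<times> paths n)"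
    by (auto simp: inj_on_def)
  ultimately show ?thesis
    by (simp add: sum.reindex sum.cartesian_product case_prod_unfold)
qed

lemma sum_paths_1: "(\<Sum>is\<in>paths 1. f is) = (\<Sum>i<4. f [i])"
  unfolding One_nat_def sum_paths_Suc paths_0 by simp

lemma sum_paths_2: "(\<Sum>is\<in>paths 2. f is) = (\<Sum>i<4. \<Sum>j<4. f [i, j])"
  unfolding Suc_1[symmetric] One_nat_def sum_paths_Suc paths_0 by simp

lemma pauli_weight_1:
  assumes "k < 4"
  shows "pauli_weight T \<pi> 1 k = \<pi> k"
  unfolding pauli_weight_def sum_paths_1 using assms
  by (elim less_4_cases) (simp_all add: sum_lessThan_4 path_index_def path_prob_def)

text \<open>Each right-hand side collects the transitions between two indices whose XOR is the given
  value; for 0 these are the repetitions of one index.\<close>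

lemma pauli_weight_2:
  "pauli_weight T \<pi> 2 0 = T 0 0 * \<pi> 0 + T 1 1 * \<pi> 1 + T 2 2 * \<pi> 2 + T 3 3 * \<pi> 3"
  "pauli_weight T \<pi> 2 1 = T 1 0 * \<pi> 0 + T 0 1 * \<pi> 1 + T 3 2 * \<pi> 2 + T 2 3 * \<pi> 3"
  "pauli_weight T \<pi> 2 2 = T 2 0 * \<pi> 0 + T 3 1 * \<pi> 1 + T 0 2 * \<pi> 2 + T 1 3 * \<pi> 3"
  "pauli_weight T \<pi> 2 3 = T 3 0 * \<pi> 0 + T 2 1 * \<pi> 1 + T 1 2 * \<pi> 2 + T 0 3 * \<pi> 3"
  unfolding pauli_weight_def sum_paths_2
  by (simp_all add: sum_lessThan_4 path_index_def path_prob_def)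

text \<open>Equal weights at indices 1 and 2 make the self-convolution agree there too, so one
  eigenvalue is double.\<close>

lemma mutual_info_bell_proj_symmetric:
  assumes w: "pauli_weight T \<pi> n 0 = a" "pauli_weight T \<pi> n 1 = b"
    "pauli_weight T \<pi> n 2 = b" "pauli_weight T \<pi> n 3 = c"
  shows "mutual_info T \<pi> n bell_proj
    = - ((a\<^sup>2 + 2 * b\<^sup>2 + c\<^sup>2) * ln (a\<^sup>2 + 2 * b\<^sup>2 + c\<^sup>2)
         + 2 * (2 * b * (a + c) * ln (2 * b * (a + c)))
         + 2 * (a * c + b\<^sup>2) * ln (2 * (a * c + b\<^sup>2)))"
proof -
  define d where "d = xor_convolution (pauli_weight T \<pi> n) (pauli_weight T \<pi> n)"
  have "d 0 = a\<^sup>2 + 2 * b\<^sup>2 + c\<^sup>2" "d 1 = 2 * b * (a + c)" "d 2 = 2 * b * (a + c)"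
    "d 3 = 2 * (a * c + b\<^sup>2)"
    using w by (simp_all add: d_def xor_convolution_def sum_lessThan_4 power2_eq_square algebra_simps)
  then show ?thesis
    unfolding mutual_info_bell_proj d_def[symmetric] by (simp add: sum_lessThan_4)
qed


section \<open>Asymptotics\<close>

lemma mutual_info_1:
  fixes \<epsilon> :: real
  defines "p \<equiv> 1/4 + \<epsilon>"
  shows "mutual_info (transition_mat (1 - 2 * p) p ((1 - 2 * p) / 2) 0)
      (invariant_vec (1 - 2 * p) p 0) 1 bell_proj
    = - ((3/8 - \<epsilon> + 6 * \<epsilon>^2) * ln (3/8 - \<epsilon> + 6 * \<epsilon>^2)
         + 2 * ((1/4 - 4 * \<epsilon>^2) * ln (1/4 - 4 * \<epsilon>^2))
         + (1/8 + \<epsilon> + 2 * \<epsilon>^2) * ln (1/8 + \<epsilon> + 2 * \<epsilon>^2))"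
proof -
  \<comment> \<open>After one collision the weights are the invariant vector itself:
    \<open>a\<close> is p0, \<open>b\<close> is \<open>p\<close>, and the third weight is r =
    0.\<close>
  define a b where "a = 1/2 - 2 * \<epsilon>" and "b = 1/4 + \<epsilon>"
  have "a\<^sup>2 + 2 * b\<^sup>2 + 0\<^sup>2 = 3/8 - \<epsilon> + 6 * \<epsilon>^2" "2 * b * (a + 0) = 1/4 - 4 * \<epsilon>^2"
    "2 * (a * 0 + b\<^sup>2) = 1/8 + \<epsilon> + 2 * \<epsilon>^2"
    by (simp_all add: a_def b_def field_simps power2_eq_square)
  then show ?thesis
    by (subst mutual_info_bell_proj_symmetric[of _ _ _ a b 0])
      (simp_all only: pauli_weight_1, simp_all add: invariant_vec_def a_def b_def p_def)
qed

lemma mutual_info_2: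
  fixes \<epsilon> :: real
  defines "p \<equiv> 1/4 + \<epsilon>"
  shows "mutual_info (transition_mat (1 - 2 * p) p ((1 - 2 * p) / 2) 0)
      (invariant_vec (1 - 2 * p) p 0) 2 bell_proj
    = - ((3/8 - \<epsilon> + 2 * \<epsilon>^2 + 64 * \<epsilon>^4) * ln (3/8 - \<epsilon> + 2 * \<epsilon>^2 + 64 * \<epsilon>^4)
         + 2 * ((1/4 - 64 * \<epsilon>^4) * ln (1/4 - 64 * \<epsilon>^4))
         + (1/8 + \<epsilon> - 2 * \<epsilon>^2 + 64 * \<epsilon>^4) * ln (1/8 + \<epsilon> - 2 * \<epsilon>^2 + 64 * \<epsilon>^4))"
proof -
  \<comment> \<open>With p + \<Delta> = 1/2, p - \<Delta> = 2\<epsilon> and r = 0, the two-collision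
    weights are \<open>a\<close> = p0^2 + p, \<open>b\<close> = 2 p p0 and \<open>c\<close> = 4 p
    \<epsilon>.\<close>
  define a b c where "a = 1/2 - \<epsilon> + 4 * \<epsilon>^2" and "b = 1/4 - 4 * \<epsilon>^2" and "c = \<epsilon> + 4 * \<epsilon>^2"
  have "a\<^sup>2 + 2 * b\<^sup>2 + c\<^sup>2 = 3/8 - \<epsilon> + 2 * \<epsilon>^2 + 64 * \<epsilon>^4" "2 * b * (a + c) = 1/4 - 64 * \<epsilon>^4"
    "2 * (a * c + b\<^sup>2) = 1/8 + \<epsilon> - 2 * \<epsilon>^2 + 64 * \<epsilon>^4"
    by (simp_all add: a_def b_def c_def field_simps power2_eq_square power4_eq_xxxx)
  then show ?thesis
    by (subst mutual_info_bell_proj_symmetric[of _ _ _ a b c])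
      (simp_all only: pauli_weight_2, simp_all add: transition_mat_def invariant_vec_def
        a_def b_def c_def p_def field_simps power2_eq_square)
qed

text \<open>The two spectra agree to first order in \<epsilon>, so the difference starts at
  \<epsilon>^2. Its coefficient is left as a combination of logarithms of the limiting eigenvalues
  3/8, 1/4 and 1/8, the form in which the expansion produces it.\<close>

lemma entropy_difference_expansion:
  "(\<lambda>\<epsilon>::real. ((3/8 - \<epsilon> + 6 * \<epsilon>^2) * ln (3/8 - \<epsilon> + 6 * \<epsilon>^2)
         + 2 * ((1/4 - 4 * \<epsilon>^2) * ln (1/4 - 4 * \<epsilon>^2))
         + (1/8 + \<epsilon> + 2 * \<epsilon>^2) * ln (1/8 + \<epsilon> + 2 * \<epsilon>^2))
    - ((3/8 - \<epsilon> + 2 * \<epsilon>^2 + 64 * \<epsilon>^4) * ln (3/8 - \<epsilon> + 2 * \<epsilon>^2 + 64 * \<epsilon>^4)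
         + 2 * ((1/4 - 64 * \<epsilon>^4) * ln (1/4 - 64 * \<epsilon>^4))
         + (1/8 + \<epsilon> - 2 * \<epsilon>^2 + 64 * \<epsilon>^4) * ln (1/8 + \<epsilon> - 2 * \<epsilon>^2 + 64 * \<epsilon>^4))
    - (- 4 * (2 * ln (1/4) - ln (3/8) - ln (1/8)) * \<epsilon>^2)) \<in> O[at_right 0](\<lambda>\<epsilon>. \<epsilon> ^ 3)"
  by real_asymp

theorem mainTheorem5:
  fixes I :: "nat \<Rightarrow> real \<Rightarrow> real"
  assumes "\<And>n \<epsilon>. n \<ge> 1 \<Longrightarrow> 0 < \<epsilon> \<Longrightarrow> \<epsilon> < 1/4 \<Longrightarrow>
    I n \<epsilon> = (let r = 0; p = 1/4 + \<epsilon>; \<Delta> = (1 - 2 * p) / 2; p0 = 1 - 2 * p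
             in mutual_info (transition_mat p0 p \<Delta> r) (invariant_vec p0 p r) n bell_proj)"
  shows "(\<lambda>\<epsilon>. I 2 \<epsilon> - I 1 \<epsilon> - (- 4 * ln (4/3) * \<epsilon>\<^sup>2)) \<in> O[at_right 0](\<lambda>\<epsilon>. \<epsilon> ^ 3)
    \<and> (\<forall>\<^sub>F \<epsilon> in at_right 0. I 2 \<epsilon> < I 1 \<epsilon>)"
proof
  have ln_const: "2 * ln (1/4) - ln (3/8) - ln (1/8) = ln (4/3 :: real)"
    using ln_realpow[of "2::real" 2] ln_realpow[of "2::real" 3] by (simp add: ln_div)
  have near: "\<forall>\<^sub>F \<epsilon> in at_right 0. 0 < \<epsilon> \<and> \<epsilon> < (1/4 :: real)"
    by (auto simp: eventually_at_right_less eventually_at_right_field intro!: exI[of _ "1/4"])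
  show bigo: "(\<lambda>\<epsilon>. I 2 \<epsilon> - I 1 \<epsilon> - (- 4 * ln (4/3) * \<epsilon>\<^sup>2)) \<in> O[at_right 0](\<lambda>\<epsilon>. \<epsilon> ^ 3)"
  proof (rule landau_o.big.in_cong[THEN iffD2, OF _ entropy_difference_expansion])
    show "\<forall>\<^sub>F \<epsilon> in at_right 0. I 2 \<epsilon> - I 1 \<epsilon> - (- 4 * ln (4/3) * \<epsilon>\<^sup>2) =
      ((3/8 - \<epsilon> + 6 * \<epsilon>^2) * ln (3/8 - \<epsilon> + 6 * \<epsilon>^2)
         + 2 * ((1/4 - 4 * \<epsilon>^2) * ln (1/4 - 4 * \<epsilon>^2))
         + (1/8 + \<epsilon> + 2 * \<epsilon>^2) * ln (1/8 + \<epsilon> + 2 * \<epsilon>^2))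
    - ((3/8 - \<epsilon> + 2 * \<epsilon>^2 + 64 * \<epsilon>^4) * ln (3/8 - \<epsilon> + 2 * \<epsilon>^2 + 64 * \<epsilon>^4)
         + 2 * ((1/4 - 64 * \<epsilon>^4) * ln (1/4 - 64 * \<epsilon>^4))
         + (1/8 + \<epsilon> - 2 * \<epsilon>^2 + 64 * \<epsilon>^4) * ln (1/8 + \<epsilon> - 2 * \<epsilon>^2 + 64 * \<epsilon>^4))
    - (- 4 * (2 * ln (1/4) - ln (3/8) - ln (1/8)) * \<epsilon>^2)"
      using near
    proof eventually_elim
      case (elim \<epsilon>)
      then show ?case
        using assms[of 1 \<epsilon>] assms[of 2 \<epsilon>]
        unfolding Let_def mutual_info_1 mutual_info_2 ln_const by linarith
    qed
  qed
  obtain C where "C > 0" and C: "\<forall>\<^sub>F \<epsilon> in at_right 0.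
      norm (I 2 \<epsilon> - I 1 \<epsilon> - (- 4 * ln (4/3) * \<epsilon>\<^sup>2)) \<le> C * norm (\<epsilon> ^ 3)"
    using bigo by (rule landau_o.bigE)
  \<comment> \<open>Below this threshold the cubic error C \<epsilon>^3 is smaller than the leading
    decrease 4 ln(4/3) \<epsilon>^2.\<close>
  define \<delta> where "\<delta> = 4 * ln (4/3) / C"
  have "\<delta> > 0" using \<open>C > 0\<close> by (simp add: \<delta>_def)
  then have "\<forall>\<^sub>F \<epsilon> in at_right 0. \<epsilon> < \<delta>"
    by (auto simp: eventually_at_right_field)
  then show "\<forall>\<^sub>F \<epsilon> in at_right 0. I 2 \<epsilon> < I 1 \<epsilon>"
    using near C
  proof eventually_elim
    case (elim \<epsilon>)
    then have "I 2 \<epsilon> - I 1 \<epsilon> - (- 4 * ln (4/3) * \<epsilon>\<^sup>2) \<le> C * \<epsilon> ^ 3"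
      by (simp add: norm_power)
    then have "I 2 \<epsilon> - I 1 \<epsilon> \<le> (C * \<epsilon> - 4 * ln (4/3)) * \<epsilon>\<^sup>2"
      by (simp add: algebra_simps power2_eq_square power3_eq_cube)
    also have "\<dots> < 0"
      using elim \<open>C > 0\<close> by (intro mult_neg_pos) (simp_all add: \<delta>_def field_simps)
    finally show ?case by simp
  qed
qed

end
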